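(* Let $(X,\varsigma)$ be a locally solid lattice, $Y$ a vector lattice, and $T:X\to Y$ a positive quasi Levi operator. Then each operator $S:X\to Y$ with $0\le S\le T$ is also quasi Levi.
   Context: All vector spaces are real, operators are linear (not assumed continuous), vector topologies are Hausdorff, vector lattices are Archimedean. A locally solid lattice is a vector lattice with a linear topology having a base at zero of solid sets. A net $(y_\alpha)_{\alpha\in A}$ in a vector lattice $Y$ is order convergent ($o$-convergent) to $y$ if there is a net $(z_\beta)_{\beta\in B}$ in $Y$ with $z_\beta\downarrow 0$ such that for each $\beta$ there is $\alpha_\beta\in A$ with $|y_\alpha-y|\le z_\beta$ for all $\alpha\ge\alpha_\beta$. The net is $o$-Cauchy if the double net $(y_{\alpha_1}-y_{\alpha_2})_{(\alpha_1,\alpha_2)}$ is $o$-convergent to $0$, i.e. there is a net $z_\beta\downarrow0$ such that for each $\beta$ there is $\alpha_\beta$ with $|y_{\alpha_1}-y_{\alpha_2}|\le z_\beta$ for all $\alpha_1,\alpha_2\ge\alpha_\beta$. An operator $T:X\to Y$ is quasi Levi if $T$ takes $\varsigma$-bounded increasing nets in $X_+$ to $o$-Cauchy nets in $Y$. For operators, $0\le S\le T$ means that $S$ and $T-S$ are positive. *)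

theory Defs
  imports Complex_Main "HOL-Library.Lattice_Algebras"
begin

class archimedean_vector_lattice = ordered_real_vector + lattice_ab_group_add_abs +
  assumes archimedean: "0 \<le> x \<Longrightarrow> (\<forall>n::nat. real n *\<^sub>R x \<le> y) \<Longrightarrow> x = 0"

definition (in archimedean_vector_lattice) solid :: "'a set \<Rightarrow> bool" where
  "solid V \<longleftrightarrow> (\<forall>x\<in>V. \<forall>y. \<bar>y\<bar> \<le> \<bar>x\<bar> \<longrightarrow> y \<in> V)"

text \<open>
  The members of the base at zero are neighbourhoods of zero, not necessarily open sets.
\<close>

class locally_solid_lattice = archimedean_vector_lattice + t2_space + topological_ab_group_add +
  assumes tendsto_scaleR_Pair:
      "LIM p (nhds c \<times>\<^sub>F nhds a). fst p *\<^sub>R snd p :> nhds (c *\<^sub>R a)"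
    and solid_base_at_zero:
      "open U \<Longrightarrow> 0 \<in> U \<Longrightarrow> \<exists>V W. solid V \<and> open W \<and> 0 \<in> W \<and> W \<subseteq> V \<and> V \<subseteq> U"

definition topologically_bounded :: "'a::locally_solid_lattice set \<Rightarrow> bool" where
  "topologically_bounded D \<longleftrightarrow>
     (\<forall>U. open U \<and> 0 \<in> U \<longrightarrow> (\<exists>c>0. \<forall>x\<in>D. c *\<^sub>R x \<in> U))"

text \<open>
  A net is a function on an index set \<open>A\<close> directed by a preorder \<open>r\<close>, where
  \<open>(a, b) \<in> r\<close> means \<open>a \<le> b\<close>; values of the function outside \<open>A\<close> are irrelevant.
\<close>

definition directed_set :: "'i set \<Rightarrow> 'i rel \<Rightarrow> bool" where
  "directed_set A r \<longleftrightarrow> A \<noteq> {} \<and> preorder_on A r \<and>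
     (\<forall>a\<in>A. \<forall>b\<in>A. \<exists>c\<in>A. (a, c) \<in> r \<and> (b, c) \<in> r)"

definition increasing_net :: "'i set \<Rightarrow> 'i rel \<Rightarrow> ('i \<Rightarrow> 'a::order) \<Rightarrow> bool" where
  "increasing_net A r x \<longleftrightarrow>
     directed_set A r \<and> (\<forall>a\<in>A. \<forall>b\<in>A. (a, b) \<in> r \<longrightarrow> x a \<le> x b)"

definition decreases_to_zero ::
    "'i set \<Rightarrow> 'i rel \<Rightarrow> ('i \<Rightarrow> 'a::archimedean_vector_lattice) \<Rightarrow> bool" where
  "decreases_to_zero B s z \<longleftrightarrow>
     directed_set B s \<and> (\<forall>a\<in>B. \<forall>b\<in>B. (a, b) \<in> s \<longrightarrow> z b \<le> z a) \<and>
     (\<forall>b\<in>B. 0 \<le> z b) \<and> (\<forall>w. (\<forall>b\<in>B. w \<le> z b) \<longrightarrow> w \<le> 0)"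

definition order_dominated ::
    "'i set \<Rightarrow> 'i rel \<Rightarrow> ('i \<Rightarrow> 'a::archimedean_vector_lattice) \<Rightarrow> 'a \<Rightarrow> 'j set \<Rightarrow> ('j \<Rightarrow> 'a) \<Rightarrow> bool" where
  "order_dominated A r y l B z \<longleftrightarrow>
     (\<forall>b\<in>B. \<exists>a0\<in>A. \<forall>a\<in>A. (a0, a) \<in> r \<longrightarrow> \<bar>y a - l\<bar> \<le> z b)"

text \<open>
  HOL cannot quantify over the type of the index \<open>\<beta>\<close>. Index sets inside the type of the
  lattice itself suffice, by lemma \<open>order_convergentI\<close> below.
\<close>

definition order_convergent ::
    "'i set \<Rightarrow> 'i rel \<Rightarrow> ('i \<Rightarrow> 'a::archimedean_vector_lattice) \<Rightarrow> 'a \<Rightarrow> bool" where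
  "order_convergent A r y l \<longleftrightarrow>
     (\<exists>(B :: 'a set) s (z :: 'a \<Rightarrow> 'a). decreases_to_zero B s z \<and> order_dominated A r y l B z)"

definition double_rel :: "'i rel \<Rightarrow> ('i \<times> 'i) rel" where
  "double_rel r = {((a1, a2), (b1, b2)). (a1, b1) \<in> r \<and> (a2, b2) \<in> r}"

definition order_Cauchy ::
    "'i set \<Rightarrow> 'i rel \<Rightarrow> ('i \<Rightarrow> 'a::archimedean_vector_lattice) \<Rightarrow> bool" where
  "order_Cauchy A r y \<longleftrightarrow>
     order_convergent (A \<times> A) (double_rel r) (\<lambda>(a1, a2). y a1 - y a2) 0"

definition positive_operator ::
    "('a::archimedean_vector_lattice \<Rightarrow> 'b::archimedean_vector_lattice) \<Rightarrow> bool" where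
  "positive_operator T \<longleftrightarrow> linear T \<and> (\<forall>x. 0 \<le> x \<longrightarrow> 0 \<le> T x)"

text \<open>
  As before, the index type has to be fixed; nets indexed in the domain of the operator suffice,
  by lemma \<open>quasi_LeviD\<close> below.
\<close>

definition quasi_Levi ::
    "('a::locally_solid_lattice \<Rightarrow> 'b::archimedean_vector_lattice) \<Rightarrow> bool" where
  "quasi_Levi T \<longleftrightarrow>
     (\<forall>(A :: 'a set) r (x :: 'a \<Rightarrow> 'a).
        increasing_net A r x \<and> (\<forall>a\<in>A. 0 \<le> x a) \<and> topologically_bounded (x ` A) \<longrightarrow>
        order_Cauchy A r (\<lambda>a. T (x a)))"

lemma order_convergentI:
  fixes z :: "'j \<Rightarrow> 'a::archimedean_vector_lattice"
  assumes z: "decreases_to_zero B s z" and dom: "order_dominated A r y l B z"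
  shows "order_convergent A r y l"
proof -
  let ?s = "{(u, v). u \<in> z ` B \<and> v \<in> z ` B \<and> v \<le> u}"
  have "preorder_on (z ` B) ?s"
    by (auto simp: preorder_on_def refl_on_def trans_def)
  moreover have "\<exists>w\<in>z ` B. (u, w) \<in> ?s \<and> (v, w) \<in> ?s" if uv: "u \<in> z ` B" "v \<in> z ` B" for u v
  proof -
    obtain a b where "a \<in> B" "u = z a" "b \<in> B" "v = z b" using uv by auto
    moreover then obtain c where "c \<in> B" "(a, c) \<in> s" "(b, c) \<in> s"
      using z unfolding decreases_to_zero_def directed_set_def by metis
    ultimately show ?thesis using z unfolding decreases_to_zero_def by auto
  qed
  ultimately have "directed_set (z ` B) ?s"
    using z unfolding directed_set_def decreases_to_zero_def by auto
  hence "decreases_to_zero (z ` B) ?s (\<lambda>u. u)"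
    using z unfolding decreases_to_zero_def by auto
  moreover have "order_dominated A r y l (z ` B) (\<lambda>u. u)"
    using dom unfolding order_dominated_def by auto
  ultimately show ?thesis unfolding order_convergent_def by blast
qed

lemma order_dominated_double:
  assumes "directed_set A r"
  shows "order_dominated (A \<times> A) (double_rel r) (\<lambda>(a1, a2). y a1 - y a2) 0 B z \<longleftrightarrow>
    (\<forall>b\<in>B. \<exists>a0\<in>A. \<forall>a1\<in>A. \<forall>a2\<in>A. (a0, a1) \<in> r \<and> (a0, a2) \<in> r \<longrightarrow> \<bar>y a1 - y a2\<bar> \<le> z b)"
    (is "?L \<longleftrightarrow> ?R")
proof
  assume ?R
  show ?L
    unfolding order_dominated_def double_rel_def
  proof
    fix b assume "b \<in> B"
    with \<open>?R\<close> obtain a0 where "a0 \<in> A"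
      "\<forall>a1\<in>A. \<forall>a2\<in>A. (a0, a1) \<in> r \<and> (a0, a2) \<in> r \<longrightarrow> \<bar>y a1 - y a2\<bar> \<le> z b" by blast
    thus "\<exists>p0\<in>A \<times> A. \<forall>p\<in>A \<times> A.
        (p0, p) \<in> {((a1, a2), (b1, b2)). (a1, b1) \<in> r \<and> (a2, b2) \<in> r} \<longrightarrow>
        \<bar>(case p of (a1, a2) \<Rightarrow> y a1 - y a2) - 0\<bar> \<le> z b"
      by (intro bexI[of _ "(a0, a0)"]) auto
  qed
next
  assume ?L
  show ?R
  proof
    fix b assume "b \<in> B"
    with \<open>?L\<close> obtain c d where cd: "c \<in> A" "d \<in> A"
      and *: "\<forall>a1\<in>A. \<forall>a2\<in>A. (c, a1) \<in> r \<and> (d, a2) \<in> r \<longrightarrow> \<bar>y a1 - y a2\<bar> \<le> z b"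
      unfolding order_dominated_def double_rel_def by fastforce
    obtain a0 where a0: "a0 \<in> A" "(c, a0) \<in> r" "(d, a0) \<in> r"
      using assms cd unfolding directed_set_def by metis
    have "trans r" using assms unfolding directed_set_def preorder_on_def by blast
    with a0 * show "\<exists>a0\<in>A. \<forall>a1\<in>A. \<forall>a2\<in>A. (a0, a1) \<in> r \<and> (a0, a2) \<in> r \<longrightarrow> \<bar>y a1 - y a2\<bar> \<le> z b"
      by (meson transD)
  qed
qed

lemma quasi_LeviD:
  fixes A :: "'i set" and T :: "'a::locally_solid_lattice \<Rightarrow> 'b::archimedean_vector_lattice"
  assumes T: "quasi_Levi T" and x: "increasing_net A r x" "\<forall>a\<in>A. 0 \<le> x a"
    and bdd: "topologically_bounded (x ` A)"
  shows "order_Cauchy A r (\<lambda>a. T (x a))"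
proof -
  let ?D = "x ` A"
  let ?r = "{(u, v). u \<in> ?D \<and> v \<in> ?D \<and> u \<le> v}"
  have A: "directed_set A r" using x unfolding increasing_net_def by blast
  have "preorder_on ?D ?r"
    by (auto simp: preorder_on_def refl_on_def trans_def)
  moreover have "\<exists>w\<in>?D. (u, w) \<in> ?r \<and> (v, w) \<in> ?r" if uv: "u \<in> ?D" "v \<in> ?D" for u v
  proof -
    obtain a b where "a \<in> A" "u = x a" "b \<in> A" "v = x b" using uv by auto
    moreover then obtain c where "c \<in> A" "(a, c) \<in> r" "(b, c) \<in> r"
      using A unfolding directed_set_def by metis
    ultimately show ?thesis using x unfolding increasing_net_def by auto
  qed
  ultimately have D: "directed_set ?D ?r"
    using A unfolding directed_set_def by auto
  hence "increasing_net ?D ?r (\<lambda>u. u)" unfolding increasing_net_def by auto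
  moreover have "\<forall>u\<in>?D. 0 \<le> u" "topologically_bounded ((\<lambda>u. u) ` ?D)" using x bdd by auto
  ultimately have "order_Cauchy ?D ?r (\<lambda>u. T u)"
    using T unfolding quasi_Levi_def by blast
  then obtain B :: "'b set" and s z where z: "decreases_to_zero B s z"
    and dom: "order_dominated (?D \<times> ?D) (double_rel ?r) (\<lambda>(u, v). T u - T v) 0 B z"
    unfolding order_Cauchy_def order_convergent_def by blast
  have "\<exists>a0\<in>A. \<forall>a1\<in>A. \<forall>a2\<in>A. (a0, a1) \<in> r \<and> (a0, a2) \<in> r \<longrightarrow> \<bar>T (x a1) - T (x a2)\<bar> \<le> z b"
    if b: "b \<in> B" for b
  proof -
    obtain a0 where a0: "a0 \<in> A" and
      *: "\<forall>u\<in>?D. \<forall>v\<in>?D. (x a0, u) \<in> ?r \<and> (x a0, v) \<in> ?r \<longrightarrow> \<bar>T u - T v\<bar> \<le> z b"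
      using dom b unfolding order_dominated_double[OF D] by blast
    have "\<bar>T (x a1) - T (x a2)\<bar> \<le> z b"
      if "a1 \<in> A" "a2 \<in> A" "(a0, a1) \<in> r" "(a0, a2) \<in> r" for a1 a2
      using * that a0 x(1) unfolding increasing_net_def by auto
    with a0 show ?thesis by blast
  qed
  hence "order_dominated (A \<times> A) (double_rel r) (\<lambda>(a1, a2). T (x a1) - T (x a2)) 0 B z"
    unfolding order_dominated_double[OF A] by blast
  with z show ?thesis
    unfolding order_Cauchy_def order_convergent_def by blast
qed

end

theory Submission
  imports Defs
begin

text \<open>
  If \<open>0 \<le> S \<le> T\<close> and \<open>x\<close> is an increasing net, then \<open>S x\<close> is increasing and between two comparable
  indices it grows by no more than \<open>T x\<close> does, since \<open>(T - S) x\<close> is increasing as well. An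
  increasing net whose increments are bounded by those of an \<open>o\<close>-Cauchy net is itself
  \<open>o\<close>-Cauchy, with the same dominating net (lemma \<open>order_Cauchy_of_increments_le\<close>); this is
  applied to \<open>S x\<close> and \<open>T x\<close>.
\<close>

lemma positive_operator_mono:
  assumes "positive_operator S" "u \<le> v"
  shows "S u \<le> S v"
proof -
  have "0 \<le> S (v - u)" and "S (v - u) = S v - S u"
    using assms unfolding positive_operator_def by (simp, metis linear_diff)
  thus ?thesis by simp
qed

text \<open>
  Two arbitrary members \<open>y a1\<close>, \<open>y a2\<close> of a tail need not have comparable indices, so their
  difference is not an increment. But both lie in the order interval between \<open>y a0\<close>, the start of
  the tail, and \<open>y a3\<close> for a common upper bound \<open>a3\<close>, and the length \<open>y a3 - y a0\<close> of that
  interval is an increment.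
\<close>

lemma order_Cauchy_of_increments_le:
  assumes incr: "increasing_net A r y"
    and le: "\<And>a b. a \<in> A \<Longrightarrow> b \<in> A \<Longrightarrow> (a, b) \<in> r \<Longrightarrow> y b - y a \<le> w b - w a"
    and w: "order_Cauchy A r w"
  shows "order_Cauchy A r y"
proof -
  have A: "directed_set A r"
    and mono: "\<And>a b. a \<in> A \<Longrightarrow> b \<in> A \<Longrightarrow> (a, b) \<in> r \<Longrightarrow> y a \<le> y b"
    using incr unfolding increasing_net_def by auto
  have refl: "refl_on A r" and trans: "trans r"
    using A unfolding directed_set_def preorder_on_def by auto
  obtain B :: "'b set" and s z where z: "decreases_to_zero B s z"
    and dom: "\<forall>b\<in>B. \<exists>a0\<in>A. \<forall>a1\<in>A. \<forall>a2\<in>A. (a0, a1) \<in> r \<and> (a0, a2) \<in> r \<longrightarrow> \<bar>w a1 - w a2\<bar> \<le> z b"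
    using w unfolding order_Cauchy_def order_convergent_def order_dominated_double[OF A] by blast
  have "\<exists>a0\<in>A. \<forall>a1\<in>A. \<forall>a2\<in>A. (a0, a1) \<in> r \<and> (a0, a2) \<in> r \<longrightarrow> \<bar>y a1 - y a2\<bar> \<le> z b"
    if b: "b \<in> B" for b
  proof -
    obtain a0 where a0: "a0 \<in> A"
      and tail: "\<And>a1 a2. a1 \<in> A \<Longrightarrow> a2 \<in> A \<Longrightarrow> (a0, a1) \<in> r \<Longrightarrow> (a0, a2) \<in> r \<Longrightarrow> \<bar>w a1 - w a2\<bar> \<le> z b"
      using dom b by blast
    have "\<bar>y a1 - y a2\<bar> \<le> z b"
      if a: "a1 \<in> A" "a2 \<in> A" "(a0, a1) \<in> r" "(a0, a2) \<in> r" for a1 a2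
    proof -
      obtain a3 where a3: "a3 \<in> A" "(a1, a3) \<in> r" "(a2, a3) \<in> r"
        using A a unfolding directed_set_def by metis
      have r03: "(a0, a3) \<in> r" using trans a a3 by (meson transD)
      have r00: "(a0, a0) \<in> r" using refl a0 by (rule refl_onD)
      have "y a3 - y a0 \<le> w a3 - w a0" using le a0 a3(1) r03 .
      also have "\<dots> \<le> \<bar>w a3 - w a0\<bar>" by (rule abs_ge_self)
      also have "\<dots> \<le> z b" using tail a3(1) a0 r03 r00 .
      finally have bound: "y a3 - y a0 \<le> z b" .
      have "y a1 - y a2 \<le> y a3 - y a0" "y a2 - y a1 \<le> y a3 - y a0"
        using mono a a0 a3 by (auto intro!: diff_mono)
      with bound show ?thesis
        by (intro abs_leI) (auto intro: order_trans)
    qed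
    with a0 show ?thesis by blast
  qed
  with z show ?thesis
    unfolding order_Cauchy_def order_convergent_def order_dominated_double[OF A] by blast
qed

theorem theorem2p7:
  fixes S T :: "'x::locally_solid_lattice \<Rightarrow> 'y::archimedean_vector_lattice"
  assumes "positive_operator T"
    and "quasi_Levi T"
    and "positive_operator S"
    and "positive_operator (\<lambda>v. T v - S v)"
  shows "quasi_Levi S"
  unfolding quasi_Levi_def
proof (intro allI impI, elim conjE)
  fix A :: "'x set" and r and x :: "'x \<Rightarrow> 'x"
  assume x: "increasing_net A r x" "\<forall>a\<in>A. 0 \<le> x a" "topologically_bounded (x ` A)"
  show "order_Cauchy A r (\<lambda>a. S (x a))"
  proof (rule order_Cauchy_of_increments_le)
    show "increasing_net A r (\<lambda>a. S (x a))"
      using x(1) positive_operator_mono[OF assms(3)] unfolding increasing_net_def by blast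
    show "order_Cauchy A r (\<lambda>a. T (x a))"
      using quasi_LeviD[OF assms(2) x] .
    fix a b assume "a \<in> A" "b \<in> A" "(a, b) \<in> r"
    hence "x a \<le> x b" using x(1) unfolding increasing_net_def by blast
    from positive_operator_mono[OF assms(4) this]
    show "S (x b) - S (x a) \<le> T (x b) - T (x a)"
      by (simp add: algebra_simps)
  qed
qed

end
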